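(* Let $\ell \ge 2$ be an integer, let $k \ge 4\ell+1$ be an odd integer, let $c$ be a positive real number, and let $G$ be a $\mathcal{C}_{2\ell} \cup \{C_k\}$-free graph on $n$ vertices with minimum degree at least $c n^{1/\ell}$. Then $$\chi(G) < \frac{(4k)^{\ell+1}}{c^{\ell}}.$$
   Context: Graphs are finite and simple. $C_j$ denotes the cycle of length $j$, and $\mathcal{C}_{2\ell} = \{C_4, C_6, \dots, C_{2\ell}\}$. A graph is $\mathcal{F}$-free if it contains no member of the family $\mathcal{F}$ as a (not necessarily induced) subgraph. $\chi(G)$ is the chromatic number of $G$. *)

theory Defs
  imports Complex_Main "Graph_Theory.Graph_Theory"
begin

text \<open>
  A finite simple graph is a \<^locale>\<open>pair_graph\<close>: a finite vertex set with a symmetric,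
  irreflexive set of ordered pairs, so each edge \<open>uv\<close> appears as both \<open>(u, v)\<close> and \<open>(v, u)\<close>.
  In particular the degree of a vertex is its out-degree.  The null graph is allowed.
\<close>

definition contains_copy :: "'a pair_pre_digraph \<Rightarrow> 'b pair_pre_digraph \<Rightarrow> bool" where
  "contains_copy G H \<longleftrightarrow>
     (\<exists>H' :: 'a pair_pre_digraph.
        subgraph (with_proj H') (with_proj G) \<and> digraph_iso (with_proj H) (with_proj H'))"

definition family_free :: "'b pair_pre_digraph set \<Rightarrow> 'a pair_pre_digraph \<Rightarrow> bool" where
  "family_free F G \<longleftrightarrow> (\<forall>H \<in> F. \<not> contains_copy G H)"

text \<open>The cycle of length \<open>j\<close> on the vertices \<open>0, \<dots>, j - 1\<close>; meaningful for \<open>j \<ge> 3\<close>.\<close>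

definition cycle_graph :: "nat \<Rightarrow> nat pair_pre_digraph" where
  "cycle_graph j =
     \<lparr> pverts = {..<j},
       parcs = {(u, v). u < j \<and> v < j \<and> (v = Suc u mod j \<or> u = Suc v mod j)} \<rparr>"

definition even_cycles :: "nat \<Rightarrow> nat pair_pre_digraph set" where
  "even_cycles l = {cycle_graph (2 * i) | i. 2 \<le> i \<and> i \<le> l}"

text \<open>For the null graph the value is unspecified.\<close>

definition min_degree :: "'a pair_pre_digraph \<Rightarrow> nat" where
  "min_degree G = Min (out_degree (with_proj G) ` pverts G)"

definition proper_coloring :: "'a pair_pre_digraph \<Rightarrow> nat \<Rightarrow> ('a \<Rightarrow> nat) \<Rightarrow> bool" where
  "proper_coloring G m f \<longleftrightarrow>
     f ` pverts G \<subseteq> {..<m} \<and> (\<forall>(u, v) \<in> parcs G. f u \<noteq> f v)"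

definition chromatic_number :: "'a pair_pre_digraph \<Rightarrow> nat" where
  "chromatic_number G = (LEAST m. \<exists>f. proper_coloring G m f)"

lemma pair_graph_cycle_graph:
  assumes "j \<ge> 3"
  shows "pair_graph (cycle_graph j)"
proof
  have "parcs (cycle_graph j) \<subseteq> {..<j} \<times> {..<j}"
    by (auto simp: cycle_graph_def)
  then show "finite (parcs (cycle_graph j))"
    by (rule finite_subset) auto
  show "symmetric (with_proj (cycle_graph j))"
    by (auto simp: symmetric_def cycle_graph_def intro!: symI)
  fix e assume "e \<in> parcs (cycle_graph j)"
  moreover have "Suc u mod j \<noteq> u" if "u < j" for u
    using that assms by (cases "Suc u = j") auto
  ultimately show "fst e \<noteq> snd e"
    by (auto simp: cycle_graph_def) metis+
qed (auto simp: cycle_graph_def)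

lemma contains_copy_iff:
  assumes "pair_graph G" "pair_graph H"
  shows "contains_copy G H \<longleftrightarrow>
    (\<exists>f. inj_on f (pverts H) \<and> f ` pverts H \<subseteq> pverts G \<and>
         (\<forall>(u, v) \<in> parcs H. (f u, f v) \<in> parcs G))"
    (is "?L \<longleftrightarrow> ?R")
proof
  assume ?L
  then obtain H' h where
    sub: "subgraph (with_proj H') (with_proj G)" and
    hom: "pre_digraph.digraph_isomorphism (with_proj H) h" and
    app: "with_proj H' = app_iso h (with_proj H)"
    by (auto simp: contains_copy_def digraph_iso_def)
  have v: "pverts H' = iso_verts h ` pverts H"
    using arg_cong[OF app, of verts] by simp
  have a: "parcs H' = iso_arcs h ` parcs H"
    using arg_cong[OF app, of arcs] by simp
  have t: "iso_tail h = fst" and hd: "iso_head h = snd"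
    using arg_cong[OF app, of tail] arg_cong[OF app, of head] by simp_all
  have "(iso_verts h x, iso_verts h y) \<in> parcs G" if xy: "(x, y) \<in> parcs H" for x y
  proof -
    have "iso_verts h x = fst (iso_arcs h (x, y))" "iso_verts h y = snd (iso_arcs h (x, y))"
      using hom xy t hd by (auto simp: pre_digraph.digraph_isomorphism_def)
    then have "(iso_verts h x, iso_verts h y) = iso_arcs h (x, y)" by simp
    then show ?thesis using sub a xy by (auto simp: subgraph_def)
  qed
  moreover have "inj_on (iso_verts h) (pverts H)"
    using hom by (simp add: pre_digraph.digraph_isomorphism_def)
  moreover have "iso_verts h ` pverts H \<subseteq> pverts G"
    using sub v by (auto simp: subgraph_def)
  ultimately show ?R by blast
next
  interpret G: pair_graph G by fact
  interpret H: pair_graph H by fact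
  assume ?R
  then obtain f where inj: "inj_on f (pverts H)" and vs: "f ` pverts H \<subseteq> pverts G"
    and "\<forall>(u, v) \<in> parcs H. (f u, f v) \<in> parcs G"
    by (elim exE conjE)
  then have es: "(f u, f v) \<in> parcs G" if "(u, v) \<in> parcs H" for u v
    using that by (auto dest: bspec)
  define H' where "H' = \<lparr> pverts = f ` pverts H, parcs = map_prod f f ` parcs H \<rparr>"
  define h where
    "h = \<lparr> iso_verts = f, iso_arcs = map_prod f f, iso_head = snd, iso_tail = fst \<rparr>"
  have wf: "wf_digraph (with_proj H')"
    by unfold_locales (auto simp: H'_def dest: H.in_arcsD1 H.in_arcsD2)
  have "subgraph (with_proj H') (with_proj G)"
    using vs es wf G.wf_digraph by (auto simp: subgraph_def compatible_def H'_def)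
  moreover have "inj_on (map_prod f f) (parcs H)"
    by (rule inj_on_subset[OF map_prod_inj_on[OF inj inj]]) (auto dest: H.in_arcsD1 H.in_arcsD2)
  then have "pre_digraph.digraph_isomorphism (with_proj H) h"
    using inj H.wf_digraph by (auto simp: pre_digraph.digraph_isomorphism_def h_def)
  moreover have "with_proj H' = app_iso h (with_proj H)"
    by (simp add: app_iso_def with_proj_def H'_def h_def)
  ultimately show ?L
    unfolding contains_copy_def digraph_iso_def by blast
qed

lemma proper_coloring_chromatic_number:
  fixes G :: "'a pair_pre_digraph"
  assumes "pair_graph G"
  shows "\<exists>f. proper_coloring G (chromatic_number G) f"
proof -
  interpret pair_graph G by fact
  obtain f :: "'a \<Rightarrow> nat" where f: "bij_betw f (pverts G) {..<card (pverts G)}"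
    using ex_bij_betw_finite_nat[OF pair_finite_verts] by (auto simp: atLeast0LessThan)
  have "f u \<noteq> f v" if "(u, v) \<in> parcs G" for u v
  proof -
    have "u \<noteq> v" using pair_no_loops[OF that] by simp
    then show ?thesis
      using in_arcsD1[OF that] in_arcsD2[OF that] f by (auto simp: bij_betw_def inj_on_def)
  qed
  then have "proper_coloring G (card (pverts G)) f"
    using f by (auto simp: proper_coloring_def bij_betw_def)
  then have "\<exists>f :: 'a \<Rightarrow> nat. proper_coloring G (card (pverts G)) f" by (rule exI[of _ f])
  then show ?thesis
    unfolding chromatic_number_def by (rule LeastI)
qed

end

theory Submission
  imports Defs
begin

text \<open>
  Since there are no short even cycles, a vertex at distance \<open>i < l\<close> from \<open>v\<close> has at most one
  neighbour at distance \<open>i - 1\<close> and at most one at distance \<open>i\<close>, and a vertex at distance \<open>i + 1\<close>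
  has only one neighbour at distance \<open>i\<close>. Hence the sphere of radius \<open>l\<close> around any vertex has at
  least \<open>(\<delta> - 2)^l\<close> elements, where \<open>\<delta>\<close> is the minimum degree, and if \<open>\<delta> \<ge> 4\<close> then at
  most \<open>2^l / c^l\<close> such spheres are pairwise disjoint (if \<open>\<delta> < 4\<close>, already \<open>n\<close> colours suffice). The centres of a maximal disjoint family are within distance
  \<open>2l\<close> of every vertex, so it suffices to colour each sphere of radius \<open>j \<le> 2l\<close> with \<open>2k\<close> colours.

  If this fails, some subset \<open>S\<close> of the sphere induces minimum degree at least \<open>2k\<close>. Take the
  breadth-first tree and the lowest tree vertex below which such an \<open>S\<close> exists, say \<open>h \<le> j\<close> levels
  up. By minimality some edge inside \<open>S\<close> joins descendants of different children of that vertex.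
  Then so do the ends of some path of odd length \<open>k - 2h\<close> inside \<open>S\<close>: otherwise
  a flexibility argument shows that every neighbour of a vertex of \<open>S\<close> lies on the same side, the
  sides alternate along paths from that edge, and odd paths cross after all. Closing the path
  through the tree gives a \<open>C\<^sub>k\<close>.
\<close>

section \<open>Cycles and paths of prescribed length\<close>

text \<open>Only lengths from 3 on give genuine cycles: in a symmetric relation a single edge with
  distinct ends already yields length 2.\<close>

definition has_cycle :: "'a rel \<Rightarrow> nat \<Rightarrow> bool" where
  "has_cycle E n \<longleftrightarrow> (\<exists>f. inj_on f {..<n} \<and> (\<forall>i<n. (f i, f (Suc i mod n)) \<in> E))"

lemma contains_copy_cycle_graph:
  assumes G: "pair_graph G" and n: "n \<ge> 3" and cyc: "has_cycle (parcs G) n"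
  shows "contains_copy G (cycle_graph n)"
proof -
  interpret pair_graph G by fact
  obtain f where inj: "inj_on f {..<n}" and f: "\<And>i. i < n \<Longrightarrow> (f i, f (Suc i mod n)) \<in> parcs G"
    using cyc by (auto simp: has_cycle_def)
  have sym: "(y, x) \<in> parcs G" if "(x, y) \<in> parcs G" for x y
    using that sym_arcs by (auto simp: symmetric_def dest: symD)
  have "f ` {..<n} \<subseteq> pverts G"
    using f in_arcsD1 by auto
  moreover have "(f u, f v) \<in> parcs G" if "(u, v) \<in> parcs (cycle_graph n)" for u v
    using that f sym by (auto simp: cycle_graph_def)
  ultimately show ?thesis
    using inj unfolding contains_copy_iff[OF G pair_graph_cycle_graph[OF n]]
    by (intro exI[of _ f]) (auto simp: cycle_graph_def)
qed

definition simple_path :: "'a rel \<Rightarrow> nat \<Rightarrow> (nat \<Rightarrow> 'a) \<Rightarrow> bool" where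
  "simple_path E s x \<longleftrightarrow> inj_on x {..s} \<and> (\<forall>i<s. (x i, x (Suc i)) \<in> E)"

lemma simple_path_Cons:
  assumes "simple_path E s x" and "(z, x 0) \<in> E" and "z \<notin> x ` {..s}"
  shows "simple_path E (Suc s) (case_nat z x)"
proof -
  have "inj_on (case_nat z x) {..Suc s}"
    using assms by (auto simp: inj_on_def simple_path_def split: nat.splits)
  then show ?thesis
    using assms by (auto simp: simple_path_def split: nat.splits)
qed

lemma simple_path_extend:
  assumes "simple_path E s x" and "(x s, z) \<in> E" and "z \<notin> x ` {..s}"
  shows "simple_path E (Suc s) (x(Suc s := z))"
proof -
  have "inj_on (x(Suc s := z)) {..Suc s}"
    using assms by (auto simp: inj_on_def simple_path_def atMost_Suc)
  then show ?thesis
    using assms by (auto simp: simple_path_def less_Suc_eq)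
qed

lemma greedy_path:
  assumes irr: "irrefl E" and y: "y \<in> S" and fin: "finite S" "finite F"
    and deg: "\<And>x. x \<in> S \<Longrightarrow> card F + t \<le> card (E `` {x} \<inter> S)"
  shows "\<exists>x. simple_path E t x \<and> x 0 = y \<and> x ` {..t} \<subseteq> S \<and> (\<forall>i\<in>{1..t}. x i \<notin> F)"
  using deg
proof (induction t)
  case 0
  then show ?case using y by (intro exI[of _ "\<lambda>_. y"]) (auto simp: simple_path_def)
next
  case (Suc t)
  then obtain x where x: "simple_path E t x" "x 0 = y" "x ` {..t} \<subseteq> S" "\<forall>i\<in>{1..t}. x i \<notin> F"
    by (metis Suc_leD add_Suc_right)
  \<comment> \<open>Of the path, only the \<open>t\<close> vertices before \<open>x t\<close> have
    to be counted: irreflexivity already keeps \<open>x t\<close> out of its own neighbourhood. This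
    makes the bound strict.\<close>
  have "card (F \<union> x ` {..<t}) \<le> card F + t"
    using card_Un_le[of F "x ` {..<t}"] card_image_le[of "{..<t}" x] by simp
  also have "\<dots> < card (E `` {x t} \<inter> S)"
    using Suc.prems[of "x t"] x(3) by auto
  finally have "\<not> E `` {x t} \<inter> S \<subseteq> F \<union> x ` {..<t}"
    using fin card_mono[of "F \<union> x ` {..<t}" "E `` {x t} \<inter> S"] by auto
  then obtain z where z: "(x t, z) \<in> E" "z \<in> S" "z \<notin> F" "z \<notin> x ` {..<t}" by auto
  moreover have "z \<noteq> x t" using z(1) irr by (auto simp: irrefl_def)
  ultimately have "z \<notin> x ` {..t}"
    by (auto simp: less_le)
  then show ?case
    using simple_path_extend[OF x(1) z(1)] x z
    by (intro exI[of _ "x(Suc t := z)"])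
      (auto simp: atMost_Suc image_iff le_Suc_eq simp del: fun_upd_apply, auto)
qed

text \<open>The factor 2 in the degree bound leaves room for two paths of length
  \<open>s - 1\<close> that start at one vertex and are otherwise disjoint, and for one more
  neighbour off both.\<close>

lemma crossing_path:
  assumes irr: "irrefl E" and sym: "sym E" and fin: "finite S"
    and deg: "\<And>x. x \<in> S \<Longrightarrow> 2 * s \<le> card (E `` {x} \<inter> S)"
    and s: "odd s" and ab: "a \<in> S" "b \<in> S" "(a, b) \<in> E" "c a \<noteq> (c b :: bool)"
  shows "\<exists>x. simple_path E s x \<and> x ` {..s} \<subseteq> S \<and> c (x 0) \<noteq> c (x s)"
proof (rule ccontr)
  assume "\<not> ?thesis"
  then have same: "c (x 0) = c (x s)" if "simple_path E s x" "x ` {..s} \<subseteq> S" for x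
    using that by blast
  obtain r where r: "s = Suc r" using s by (cases s) auto
  \<comment> \<open>A neighbour of \<open>y\<close> off a path of length \<open>s - 1\<close> starting at \<open>y\<close> has the colour of the
    other end of that path; two such paths that share only \<open>y\<close> cover all neighbours.\<close>
  have mono: "c z = c z'" if y: "y \<in> S" and z: "z \<in> S" "(y, z) \<in> E" "z' \<in> S" "(y, z') \<in> E"
    for y z z'
  proof -
    have off: "c w = c (x r)" if "simple_path E r x" "x 0 = y" "x ` {..r} \<subseteq> S"
      "w \<in> S" "(y, w) \<in> E" "w \<notin> x ` {..r}" for x w
    proof -
      have "(w, x 0) \<in> E" using that sym by (auto dest: symD)
      then have "simple_path E s (case_nat w x)"
        using simple_path_Cons that r by metis
      moreover have "case_nat w x ` {..s} \<subseteq> S"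
        using that(3,4) r by (auto simp: image_subset_iff split: nat.splits)
      ultimately show ?thesis using same[of "case_nat w x"] r by simp
    qed
    obtain x where x: "simple_path E r x" "x 0 = y" "x ` {..r} \<subseteq> S"
      using greedy_path[OF irr y fin, of "{}" r] deg r by fastforce
    let ?F = "x ` {1..r}"
    have F: "card ?F \<le> r" using card_image_le[of "{1..r}" x] by simp
    have "card ?F + r \<le> card (E `` {x} \<inter> S)" if "x \<in> S" for x
      using deg[OF that] F r by linarith
    then obtain x' where x': "simple_path E r x'" "x' 0 = y" "x' ` {..r} \<subseteq> S"
      "\<forall>i\<in>{1..r}. x' i \<notin> ?F"
      using greedy_path[OF irr y fin, of ?F r] by auto
    have img: "u ` {..r} = insert (u 0) (u ` {1..r})" for u :: "nat \<Rightarrow> 'a"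
    proof -
      have "{..r} = insert 0 {1..r}" by auto
      then show ?thesis by simp
    qed
    have ny: "w \<noteq> y" if "(y, w) \<in> E" for w using that irr by (auto simp: irrefl_def)
    \<comment> \<open>The neighbour \<open>w\<close> avoids both paths, so \<open>off\<close> gives
      it the colour of either far end; hence these ends agree.\<close>
    have "card (?F \<union> x' ` {1..r}) \<le> r + r"
      using card_Un_le[of ?F "x' ` {1..r}"] F card_image_le[of "{1..r}" x'] by simp
    also have "\<dots> < card (E `` {y} \<inter> S)" using deg[OF y] r by linarith
    finally have "\<not> E `` {y} \<inter> S \<subseteq> ?F \<union> x' ` {1..r}"
      using card_mono[of "?F \<union> x' ` {1..r}" "E `` {y} \<inter> S"] by fastforce
    then obtain w where w: "w \<in> S" "(y, w) \<in> E" "w \<notin> ?F" "w \<notin> x' ` {1..r}" by auto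
    have eq: "c (x r) = c (x' r)"
      using off[OF x, of w] off[OF x'(1-3), of w] w x(2) x'(2) ny[of w] by (simp add: img)
    \<comment> \<open>A neighbour of \<open>y\<close> lies on at most one of the two paths, so the
      other one determines its colour.\<close>
    have "c u = c (x r)" if "u \<in> S" "(y, u) \<in> E" for u
    proof (cases "u \<in> x ` {..r}")
      case True
      then have "u \<in> ?F" using ny[OF that(2)] x(2) by (auto simp: img)
      then have "u \<notin> x' ` {1..r}" using x'(4) by blast
      then have "u \<notin> x' ` {..r}" using x'(2) ny[OF that(2)] by (simp add: img)
      then show ?thesis using off[OF x'(1-3) that] eq by simp
    qed (use off[OF x that] in simp)
    then show ?thesis using z by simp
  qed
  have "card ({} :: 'a set) + s \<le> card (E `` {x} \<inter> S)" if "x \<in> S" for x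
    using deg[OF that] by simp
  then obtain x where x: "simple_path E s x" "x 0 = a" "x ` {..s} \<subseteq> S"
    using greedy_path[OF irr ab(1) fin, of "{}" s] by auto
  \<comment> \<open>The second conjunct drives the induction: \<open>x i\<close> is an oppositely
    coloured neighbour of \<open>x (Suc i)\<close>, and by \<open>mono\<close> all neighbours of
    \<open>x (Suc i)\<close> in \<open>S\<close> share its colour.\<close>
  have "(c (x i) \<longleftrightarrow> (c a \<longleftrightarrow> even i)) \<and> (\<forall>z\<in>S. (x i, z) \<in> E \<longrightarrow> c z \<noteq> c (x i))" if "i \<le> s" for i
    using that
  proof (induction i)
    case 0
    then show ?case using mono[OF ab(1,2,3)] ab(4) x(2) by auto
  next
    case (Suc i)
    have e: "(x i, x (Suc i)) \<in> E" "(x (Suc i), x i) \<in> E"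
      using x(1) Suc.prems symD[OF sym] by (auto simp: simple_path_def)
    have m: "x i \<in> S" "x (Suc i) \<in> S" using x(3) Suc.prems by auto
    have "c (x (Suc i)) \<noteq> c (x i)" using Suc e m by auto
    then show ?case using Suc m mono[OF m(2,1) e(2)] by auto
  qed
  from this[of s] same[OF x(1,3)] x(2) s show False by simp
qed

section \<open>Greedy colouring\<close>

text \<open>Delete a vertex with fewer than \<open>d\<close> neighbours, colour the rest by
  induction, and give the vertex a colour missing among its neighbours.\<close>

lemma degenerate_coloring:
  fixes V :: "'a set"
  assumes "finite V" and "sym E" and "irrefl E"
    and "\<And>S. S \<subseteq> V \<Longrightarrow> S \<noteq> {} \<Longrightarrow> \<exists>x\<in>S. card (E `` {x} \<inter> S) < d"
  shows "\<exists>f. f ` V \<subseteq> {..<d::nat} \<and> (\<forall>x\<in>V. \<forall>y\<in>V. (x, y) \<in> E \<longrightarrow> f x \<noteq> f y)"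
  using assms
proof (induction V rule: finite_psubset_induct)
  case (psubset V)
  show ?case
  proof (cases "V = {}")
    case False
    then obtain x where x: "x \<in> V" "card (E `` {x} \<inter> V) < d"
      using psubset.prems(3)[of V] by auto
    have "\<exists>f. f ` (V - {x}) \<subseteq> {..<d} \<and> (\<forall>u\<in>V - {x}. \<forall>w\<in>V - {x}. (u, w) \<in> E \<longrightarrow> f u \<noteq> f w)"
      using x by (intro psubset.IH psubset.prems) auto
    then obtain f where f: "f ` (V - {x}) \<subseteq> {..<d}"
      "\<And>u w. u \<in> V - {x} \<Longrightarrow> w \<in> V - {x} \<Longrightarrow> (u, w) \<in> E \<Longrightarrow> f u \<noteq> f w" by blast
    have "card (f ` (E `` {x} \<inter> V)) < card {..<d}"
      using card_image_le[of "E `` {x} \<inter> V" f] psubset.hyps x by simp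
    then have "\<not> {..<d} \<subseteq> f ` (E `` {x} \<inter> V)"
      using card_mono[of "f ` (E `` {x} \<inter> V)" "{..<d}"] psubset.hyps by auto
    then obtain q where q: "q < d" "q \<notin> f ` (E `` {x} \<inter> V)" by auto
    let ?g = "f(x := q)"
    have "?g u \<noteq> ?g w" if "u \<in> V" "w \<in> V" "(u, w) \<in> E" for u w
    proof -
      have "u \<noteq> w" "(w, u) \<in> E"
        using that psubset.prems by (auto simp: irrefl_def dest: symD)
      then show ?thesis using that q f(2) by auto
    qed
    moreover have "?g ` V \<subseteq> {..<d}" using f(1) q(1) by auto
    ultimately show ?thesis by blast
  qed auto
qed

text \<open>Allows colours of any type, such as vertices or triples.\<close>

lemma chromatic_number_le_card:
  assumes "finite T" and "g ` pverts G \<subseteq> T" and "\<And>u v. (u, v) \<in> parcs G \<Longrightarrow> g u \<noteq> g v"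
    and "pair_graph G"
  shows "chromatic_number G \<le> card T"
proof -
  interpret pair_graph G by fact
  obtain e :: "_ \<Rightarrow> nat" where e: "bij_betw e T {..<card T}"
    using ex_bij_betw_finite_nat[OF assms(1)] by (auto simp: atLeast0LessThan)
  have "e (g u) \<noteq> e (g v)" if "(u, v) \<in> parcs G" for u v
    using assms(2) assms(3)[OF that] in_arcsD1[OF that] in_arcsD2[OF that]
      inj_on_eq_iff[OF bij_betw_imp_inj_on[OF e]] by (simp add: image_subset_iff)
  then have "proper_coloring G (card T) (e \<circ> g)"
    using image_mono[OF assms(2), of e] bij_betw_imp_surj_on[OF e]
    by (auto simp: proper_coloring_def image_comp)
  then show ?thesis
    unfolding chromatic_number_def by (intro Least_le) blast
qed

section \<open>Distance spheres and the breadth-first tree\<close>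

definition sphere :: "'a rel \<Rightarrow> 'a \<Rightarrow> nat \<Rightarrow> 'a set" where
  "sphere E v i = {x. (v, x) \<in> E ^^ i \<and> (\<forall>m<i. (v, x) \<notin> E ^^ m)}"

lemma sphere_0 [simp]: "sphere E v 0 = {v}"
  by (auto simp: sphere_def)

lemma sphere_unique: "x \<in> sphere E v i \<Longrightarrow> x \<in> sphere E v j \<Longrightarrow> i = j"
  by (auto simp: sphere_def) (metis linorder_neqE_nat)

lemma sphere_pred:
  assumes "sym E" and "x \<in> sphere E v (Suc i)"
  shows "\<exists>y\<in>sphere E v i. (x, y) \<in> E"
proof -
  obtain y where y: "(v, y) \<in> E ^^ i" "(y, x) \<in> E"
    using assms(2) by (auto simp: sphere_def)
  have "(v, y) \<notin> E ^^ m" if "m < i" for m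
  proof
    assume "(v, y) \<in> E ^^ m"
    then have "(v, x) \<in> E ^^ Suc m" using y(2) by auto
    then show False using assms(2) that by (auto simp: sphere_def simp del: relpow.simps)
  qed
  then show ?thesis using y assms(1) by (auto simp: sphere_def dest: symD)
qed

lemma relpow_sphere:
  assumes "(v, x) \<in> E ^^ m"
  shows "\<exists>i\<le>m. x \<in> sphere E v i"
proof -
  let ?i = "LEAST i. (v, x) \<in> E ^^ i"
  have "(v, x) \<in> E ^^ ?i" using assms by (rule LeastI)
  moreover have "?i \<le> m" using assms by (rule Least_le)
  moreover have "(v, x) \<notin> E ^^ j" if "j < ?i" for j using that by (rule not_less_Least)
  ultimately show ?thesis by (auto simp: sphere_def)
qed

lemma relpow_sym: "sym E \<Longrightarrow> (x, y) \<in> E ^^ n \<Longrightarrow> (y, x) \<in> E ^^ n"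
proof (induction n arbitrary: y)
  case (Suc n)
  then obtain z where "(z, x) \<in> E ^^ n" "(y, z) \<in> E" by (auto dest: symD)
  then show ?case by (rule relpow_Suc_I2[rotated])
qed simp

lemma sphere_step:
  assumes "sym E" and "x \<in> sphere E v i" and "(x, y) \<in> E"
  shows "\<exists>j. y \<in> sphere E v j \<and> j \<le> Suc i \<and> i \<le> Suc j"
proof -
  have "(v, y) \<in> E ^^ Suc i" using assms by (auto simp: sphere_def)
  then obtain j where j: "j \<le> Suc i" "y \<in> sphere E v j" using relpow_sphere by metis
  then have "(v, x) \<in> E ^^ Suc j" using assms by (auto simp: sphere_def dest: symD)
  then have "i \<le> Suc j" using assms(2) unfolding sphere_def by (auto simp del: relpow.simps intro: leI)
  then show ?thesis using j by blast
qed

text \<open>A fixed choice of one neighbour a level closer to \<open>v\<close> makes a breadth-first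
  tree whose ancestors are iterates of one function. At \<open>v\<close> and at unreachable vertices
  the value is arbitrary.\<close>

definition parent :: "'a rel \<Rightarrow> 'a \<Rightarrow> 'a \<Rightarrow> 'a" where
  "parent E v x = (SOME y. (x, y) \<in> E \<and> (\<exists>i. x \<in> sphere E v (Suc i) \<and> y \<in> sphere E v i))"

lemma parent:
  assumes "sym E" and "x \<in> sphere E v (Suc i)"
  shows "(x, parent E v x) \<in> E" and "parent E v x \<in> sphere E v i"
proof -
  have "\<exists>y. (x, y) \<in> E \<and> (\<exists>i. x \<in> sphere E v (Suc i) \<and> y \<in> sphere E v i)"
    using sphere_pred[OF assms] assms(2) by blast
  from someI_ex[OF this]
  have "(x, parent E v x) \<in> E \<and> (\<exists>j. x \<in> sphere E v (Suc j) \<and> parent E v x \<in> sphere E v j)"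
    unfolding parent_def .
  then show "(x, parent E v x) \<in> E" "parent E v x \<in> sphere E v i"
    using sphere_unique[OF assms(2)] by blast+
qed

lemma funpow_parent_sphere:
  assumes "sym E" and "x \<in> sphere E v j" and "t \<le> j"
  shows "(parent E v ^^ t) x \<in> sphere E v (j - t)"
  using assms(3)
proof (induction t)
  case (Suc t)
  then have "(parent E v ^^ t) x \<in> sphere E v (Suc (j - Suc t))"
    by (simp add: Suc_diff_Suc)
  then show ?case using parent(2)[OF assms(1)] by simp
qed (use assms in simp)

lemma funpow_parent_edge:
  assumes "sym E" and "x \<in> sphere E v j" and "t < j"
  shows "((parent E v ^^ t) x, (parent E v ^^ Suc t) x) \<in> E"
  using funpow_parent_sphere[OF assms(1,2), of t] assms(3) parent(1)[OF assms(1)]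
  by (simp add: Suc_diff_Suc[symmetric])

lemma funpow_eq_mono:
  fixes p :: "'a \<Rightarrow> 'a"
  assumes "(p ^^ t) x = (p ^^ t) y" and "t \<le> u"
  shows "(p ^^ u) x = (p ^^ u) y"
  using assms funpow_add[of "u - t" t p] by simp

text \<open>The path is closed up through the breadth-first tree, in which the lowest common ancestor of
  its ends lies \<open>h + 1\<close> levels above them.\<close>

lemma tree_cycle:
  assumes sym: "sym E" and path: "simple_path E s x"
    and out: "\<And>i m. i \<le> s \<Longrightarrow> m < j \<Longrightarrow> x i \<notin> sphere E v m"
    and ends: "x 0 \<in> sphere E v j" "x s \<in> sphere E v j"
    and h: "Suc h \<le> j" "(parent E v ^^ Suc h) (x 0) = (parent E v ^^ Suc h) (x s)"
      "(parent E v ^^ h) (x 0) \<noteq> (parent E v ^^ h) (x s)"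
  shows "has_cycle E (s + 2 * Suc h)"
proof -
  let ?p = "parent E v" and ?n = "s + 2 * Suc h"
  \<comment> \<open>Follow the path to \<open>x s\<close>, climb to the common ancestor at index
    \<open>s + Suc h\<close>, then descend towards \<open>x 0\<close>. Index \<open>?n\<close> would
    be \<open>x 0\<close> again, so the closing edge is an ordinary step.\<close>
  define f where "f i = (if i \<le> s then x i else if i \<le> s + Suc h then (?p ^^ (i - s)) (x s)
    else (?p ^^ (?n - i)) (x 0))" for i
  have f0: "f ?n = f 0" by (simp add: f_def)
  have low1: "f i \<in> sphere E v (j - (i - s))" if "s < i" "i \<le> s + Suc h" for i
    using that h funpow_parent_sphere[OF sym ends(2), of "i - s"] by (auto simp: f_def)
  have low2: "f i \<in> sphere E v (j - (?n - i))" if "s + Suc h < i" "i < ?n" for i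
    using that h funpow_parent_sphere[OF sym ends(1), of "?n - i"] by (auto simp: f_def)
  \<comment> \<open>Branches that have met stay together, so being distinct at height
    \<open>h\<close> they are distinct at every smaller height.\<close>
  have ne: "(?p ^^ t) (x s) \<noteq> (?p ^^ t) (x 0)" if "t \<le> h" for t
    using that funpow_eq_mono[of t ?p "x s" "x 0" h] h(3) by auto
  have "f i \<noteq> f i'" if "i < i'" "i' < ?n" for i i'
  proof -
    consider "i' \<le> s" | "i \<le> s" "s < i'" "i' \<le> s + Suc h" | "i \<le> s" "s + Suc h < i'"
      | "s < i" "i' \<le> s + Suc h" | "s < i" "i \<le> s + Suc h" "s + Suc h < i'" | "s + Suc h < i"
      by linarith
    then show ?thesis
    proof cases
      case 1
      then show ?thesis using path that by (auto simp: f_def simple_path_def inj_on_def)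
    next
      case 2
      then have "j - (i' - s) < j" using h(1) by linarith
      then show ?thesis using 2 low1[of i'] out[of i "j - (i' - s)"] by (auto simp: f_def)
    next
      case 3
      then have "j - (?n - i') < j" using h(1) that by linarith
      then show ?thesis using 3 that low2[of i'] out[of i "j - (?n - i')"] by (auto simp: f_def)
    next
      case 4
      then show ?thesis using low1[of i] low1[of i'] that h(1)
          sphere_unique[of "f i" E v "j - (i - s)" "j - (i' - s)"] by auto
    next
      case 5
      show ?thesis
      proof
        assume eq: "f i = f i'"
        then have "j - (i - s) = j - (?n - i')"
          using low1[of i] low2[of i'] 5 that sphere_unique by fastforce
        moreover have "i - s \<le> j" "?n - i' \<le> j" using 5 h(1) by (simp_all add: le_diff_conv)
        ultimately have "i - s = ?n - i'" by (metis diff_diff_cancel)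
        moreover have "?n - i' \<le> h" using 5 by (simp add: le_diff_conv)
        ultimately show False using eq 5 ne[of "i - s"] by (auto simp: f_def)
      qed
    next
      case 6
      then show ?thesis using low2[of i] low2[of i'] that h(1)
          sphere_unique[of "f i" E v "j - (?n - i)" "j - (?n - i')"] by auto
    qed
  qed
  then have "inj_on f {..<?n}"
    by (auto simp: inj_on_def) (metis linorder_neqE_nat)
  moreover have e: "(f i, f (Suc i)) \<in> E" if "i < ?n" for i
  proof -
    consider "i < s" | "s \<le> i" "i < s + Suc h" | "s + Suc h \<le> i" by linarith
    then show ?thesis
    proof cases
      case 1
      then show ?thesis using path by (auto simp: f_def simple_path_def)
    next
      case 2
      then have "f i = (?p ^^ (i - s)) (x s)" "f (Suc i) = (?p ^^ Suc (i - s)) (x s)"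
        by (auto simp: f_def Suc_diff_le simp del: funpow.simps)
      then show ?thesis using funpow_parent_edge[OF sym ends(2), of "i - s"] 2 h(1) by simp
    next
      case 3
      define t where "t = ?n - Suc i"
      have t: "?n - i = Suc t" using that by (simp add: t_def)
      \<comment> \<open>At the top vertex \<open>f\<close> is defined by the climb from
        \<open>x s\<close>; there \<open>h(2)\<close> rewrites it as an ancestor of
        \<open>x 0\<close>.\<close>
      have "f i = (?p ^^ Suc t) (x 0)"
      proof (cases "i = s + Suc h")
        case True
        then have "t = h" using t by simp
        then show ?thesis using True h(2) by (simp add: f_def)
      qed (use 3 t in \<open>auto simp: f_def simp del: funpow.simps\<close>)
      moreover have "f (Suc i) = (?p ^^ t) (x 0)" using 3 by (simp add: f_def t_def)
      ultimately show ?thesis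
        using funpow_parent_edge[OF sym ends(1), of t] 3 h(1) that symD[OF sym]
        by (auto simp: t_def)
    qed
  qed
  have "(f i, f (Suc i mod ?n)) \<in> E" if "i < ?n" for i
    using e[OF that] that f0 by (cases "Suc i = ?n") auto
  ultimately show ?thesis unfolding has_cycle_def by blast
qed

text \<open>Both branches reach \<open>v\<close> after \<open>j\<close> steps, so a least meeting
  height exists; it is positive because \<open>x\<close> and \<open>y\<close> differ.\<close>

lemma common_ancestor:
  assumes "sym E" and "x \<in> sphere E v j" "y \<in> sphere E v j" "x \<noteq> y"
  obtains h where "Suc h \<le> j" "(parent E v ^^ Suc h) x = (parent E v ^^ Suc h) y"
    "(parent E v ^^ h) x \<noteq> (parent E v ^^ h) y"
proof -
  let ?P = "\<lambda>h. (parent E v ^^ h) x = (parent E v ^^ h) y"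
  have P: "?P j"
    using funpow_parent_sphere[OF assms(1), of _ v j j] assms(2,3) by simp
  have 0: "\<not> ?P 0" using assms(4) by simp
  obtain h where h: "Least ?P = Suc h" using LeastI[of ?P j, OF P] 0 by (cases "Least ?P") auto
  show thesis
  proof (rule that[of h])
    show "Suc h \<le> j" using Least_le[of ?P j, OF P] h by simp
    show "?P (Suc h)" using LeastI[of ?P j, OF P] unfolding h .
    show "\<not> ?P h" by (rule not_less_Least) (simp only: h lessI)
  qed
qed

section \<open>Growth of spheres without short even cycles\<close>

text \<open>Closing the path \<open>y\<close>, \<open>x\<close>, \<open>z\<close> through the tree
  would give an even cycle of length at most \<open>2 * (i + 1)\<close>, hence at most
  \<open>2 * l\<close>. It is used with \<open>x\<close> on the level of \<open>y\<close> and
  \<open>z\<close> and with \<open>x\<close> one level further out.\<close>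

lemma sphere_no_cherry:
  assumes sym: "sym E" and irr: "irrefl E"
    and no: "\<And>i. 2 \<le> i \<Longrightarrow> i \<le> l \<Longrightarrow> \<not> has_cycle E (2 * i)"
    and yz: "y \<in> sphere E v i" "z \<in> sphere E v i" and i: "i < l"
    and x: "x \<in> sphere E v j" "i \<le> j" "(x, y) \<in> E" "(x, z) \<in> E"
  shows "y = z"
proof (rule ccontr)
  assume ne: "y \<noteq> z"
  obtain h where h: "Suc h \<le> i" "(parent E v ^^ Suc h) y = (parent E v ^^ Suc h) z"
    "(parent E v ^^ h) y \<noteq> (parent E v ^^ h) z"
    using common_ancestor[OF sym yz ne] .
  define w where "w = (\<lambda>t::nat. if t = 0 then y else if t = 1 then x else z)"
  have "x \<noteq> y" "x \<noteq> z" using x irr by (auto simp: irrefl_def)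
  then have "simple_path E 2 w"
    using ne x sym by (auto simp: simple_path_def w_def inj_on_def numeral_2_eq_2 less_Suc_eq dest: symD)
  moreover have "w t \<notin> sphere E v m" if "m < i" for t m
    using that yz x(1,2) sphere_unique[of _ E v m i] sphere_unique[of x E v m j] by (auto simp: w_def)
  ultimately have "has_cycle E (2 + 2 * Suc h)"
    using tree_cycle[OF sym, of 2 w i v h] yz h by (simp add: w_def)
  then show False using no[of "Suc (Suc h)"] h(1) i by (simp add: algebra_simps)
qed

lemma sphere_subset:
  assumes "E \<subseteq> V \<times> V" and "v \<in> V"
  shows "sphere E v i \<subseteq> V"
proof -
  have "x \<in> V" if "(v, x) \<in> E ^^ i" for x
    using that assms by (cases i) auto
  then show ?thesis by (auto simp: sphere_def)
qed

lemma card_sphere_ge: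
  assumes sym: "sym E" and irr: "irrefl E" and E: "E \<subseteq> V \<times> V" and V: "finite V" "v \<in> V"
    and no: "\<And>i. 2 \<le> i \<Longrightarrow> i \<le> l \<Longrightarrow> \<not> has_cycle E (2 * i)"
    and deg: "\<And>x. x \<in> V \<Longrightarrow> D \<le> card (E `` {x})" and "i \<le> l"
  shows "(D - 2) ^ i \<le> card (sphere E v i)"
  using \<open>i \<le> l\<close>
proof (induction i)
  case (Suc i)
  let ?S = "sphere E v"
  have fS: "finite (?S m)" for m using finite_subset[OF sphere_subset[OF E V(2)] V(1)] .
  have fE: "finite (E `` {x})" for x using finite_subset[of "E `` {x}" V] E V(1) by auto
  note cherry = sphere_no_cherry[OF sym irr no]
  have one: "card A \<le> 1" if "\<And>y z. y \<in> A \<Longrightarrow> z \<in> A \<Longrightarrow> y = z" for A :: "'a set"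
  proof (cases "finite A")
    case True
    then show ?thesis using card_le_Suc0_iff_eq[of A] that by (metis One_nat_def)
  qed simp
  have ch: "D - 2 \<le> card (E `` {x} \<inter> ?S (Suc i))" if x: "x \<in> ?S i" for x
  proof -
    \<comment> \<open>Level 0 has no predecessor, whereas truncated \<open>i - 1\<close> would name
      level 0 itself.\<close>
    let ?N = "\<lambda>j. E `` {x} \<inter> ?S j" and ?up = "E `` {x} \<inter> (if i = 0 then {} else ?S (i - 1))"
    have "E `` {x} \<subseteq> ?N (Suc i) \<union> ?N i \<union> ?up"
    proof
      fix y assume y: "y \<in> E `` {x}"
      then obtain j where "y \<in> ?S j" "j \<le> Suc i" "i \<le> Suc j"
        using sphere_step[OF sym x, of y] by auto
      moreover from this have "j = Suc i \<or> j = i \<or> (i \<noteq> 0 \<and> j = i - 1)" by linarith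
      ultimately show "y \<in> ?N (Suc i) \<union> ?N i \<union> ?up" using y by auto
    qed
    then have "card (E `` {x}) \<le> card (?N (Suc i) \<union> ?N i \<union> ?up)"
      using fE by (intro card_mono) auto
    also have "\<dots> \<le> card (?N (Suc i)) + card (?N i) + card ?up"
      by (meson card_Un_le add_mono order_trans order_refl)
    also have "card (?N i) \<le> 1"
      using cherry[of l _ v i _ x i] x Suc.prems by (intro one) auto
    also have "card ?up \<le> 1"
      using cherry[of l _ v "i - 1" _ x i] x Suc.prems by (intro one) (auto split: if_splits)
    finally have "card (E `` {x}) \<le> card (E `` {x} \<inter> ?S (Suc i)) + 1 + 1" by simp
    then show ?thesis using deg[of x] x sphere_subset[OF E V(2), of i] by fastforce
  qed
  have "(D - 2) ^ Suc i \<le> (D - 2) * card (?S i)" using Suc by simp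
  also have "\<dots> \<le> (\<Sum>x\<in>?S i. card (E `` {x} \<inter> ?S (Suc i)))"
    using sum_mono[of "?S i" "\<lambda>_. D - 2", OF ch] by (simp add: mult.commute)
  also have "\<dots> = card (\<Union>x\<in>?S i. E `` {x} \<inter> ?S (Suc i))"
  proof (rule card_UN_disjoint[symmetric])
    \<comment> \<open>A common neighbour on level \<open>Suc i\<close> would have two neighbours on
      level \<open>i\<close>.\<close>
    show "\<forall>x\<in>?S i. \<forall>y\<in>?S i. x \<noteq> y \<longrightarrow> E `` {x} \<inter> ?S (Suc i) \<inter> (E `` {y} \<inter> ?S (Suc i)) = {}"
      using cherry[of l _ v i _ _ "Suc i"] Suc.prems symD[OF sym] by (auto 0 3)
  qed (use fS in auto)
  also have "\<dots> \<le> card (?S (Suc i))" using fS by (intro card_mono) auto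
  finally show ?case .
qed simp

section \<open>Colouring one sphere\<close>

lemma sphere_degenerate:
  assumes sym: "sym E" and irr: "irrefl E" and fin: "finite (sphere E v j)"
    and k: "odd k" "2 * j < k" and no: "\<not> has_cycle E k"
    and S: "S \<subseteq> sphere E v j" "S \<noteq> {}"
  shows "\<exists>x\<in>S. card (E `` {x} \<inter> S) < 2 * k"
proof (rule ccontr)
  let ?p = "parent E v"
  assume "\<not> ?thesis"
  then have deg: "\<And>x. x \<in> S \<Longrightarrow> 2 * k \<le> card (E `` {x} \<inter> S)" by (auto simp: not_less)
  \<comment> \<open>\<open>P h\<close> asks for a dense set whose members share their ancestor
    \<open>h\<close> levels up. \<open>P j\<close> holds with ancestor \<open>v\<close>;
    \<open>P 0\<close> fails because a singleton spans no edge.\<close>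
  define P where "P h \<longleftrightarrow> (\<exists>S r. S \<subseteq> sphere E v j \<and> S \<noteq> {} \<and> (\<forall>x\<in>S. 2 * k \<le> card (E `` {x} \<inter> S))
    \<and> (\<forall>x\<in>S. (?p ^^ h) x = r))" for h
  have "P j"
    unfolding P_def using S deg funpow_parent_sphere[OF sym, of _ v j j]
    by (intro exI[of _ S] exI[of _ v]) auto
  then have P: "P (LEAST h. P h)" and le: "(LEAST h. P h) \<le> j"
    by (auto intro: LeastI Least_le)
  have "\<not> P 0"
  proof
    assume "P 0"
    then obtain S r where S: "S \<noteq> {}" "\<forall>x\<in>S. 2 * k \<le> card (E `` {x} \<inter> S)" "\<forall>x\<in>S. x = r"
      by (auto simp: P_def)
    then have "S = {r}" by auto
    then have "E `` {r} \<inter> S = {}" using irr by (auto simp: irrefl_def)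
    then show False using S(2) \<open>S = {r}\<close> k by (auto simp: odd_pos)
  qed
  then obtain h where h: "(LEAST h. P h) = Suc h" using P by (cases "LEAST h. P h") auto
  have nP: "\<not> P h" using not_less_Least[of h P] h by simp
  obtain T r where T: "T \<subseteq> sphere E v j" "T \<noteq> {}" "\<And>x. x \<in> T \<Longrightarrow> 2 * k \<le> card (E `` {x} \<inter> T)"
    "\<And>x. x \<in> T \<Longrightarrow> (?p ^^ Suc h) x = r"
    using P unfolding h unfolding P_def by metis
  obtain a where a: "a \<in> T" using T(2) by blast
  \<comment> \<open>The part of \<open>T\<close> below the same child of \<open>r\<close> as
    \<open>a\<close>.\<close>
  let ?A = "{x\<in>T. (?p ^^ h) x = (?p ^^ h) a}"
  \<comment> \<open>Otherwise \<open>?A\<close> contradicts the minimality of \<open>Suc h\<close>.\<close>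
  have "\<exists>x\<in>?A. \<exists>y\<in>T - ?A. (x, y) \<in> E"
  proof (rule ccontr)
    assume "\<not> ?thesis"
    then have "E `` {x} \<inter> T = E `` {x} \<inter> ?A" if "x \<in> ?A" for x using that by blast
    then have "\<forall>x\<in>?A. 2 * k \<le> card (E `` {x} \<inter> ?A)" using T(3) by (metis (lifting) mem_Collect_eq)
    then have "P h" unfolding P_def using a T(1)
      by (intro exI[of _ ?A] exI[of _ "(?p ^^ h) a"]) auto
    then show False using nP by simp
  qed
  then obtain x y where xy: "x \<in> T" "y \<in> T" "(x, y) \<in> E" "x \<in> ?A" "y \<notin> ?A" by blast
  \<comment> \<open>With this length the tree closes the path to exactly \<open>k\<close> vertices.
    It is odd since \<open>k\<close> is, and positive since \<open>Suc h \<le> j\<close> and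
    \<open>2 * j < k\<close>.\<close>
  define s where "s = k - 2 * Suc h"
  have hj: "Suc h \<le> j" using le h by simp
  have s: "odd s" "k = s + 2 * Suc h" using k hj by (auto simp: s_def)
  have "2 * s \<le> card (E `` {x} \<inter> T)" if "x \<in> T" for x using T(3)[OF that] s by simp
  then obtain z where z: "simple_path E s z" "z ` {..s} \<subseteq> T" "(z 0 \<in> ?A) \<noteq> (z s \<in> ?A)"
    using crossing_path[OF irr sym finite_subset[OF T(1) fin], of s x y "\<lambda>x. x \<in> ?A"] s(1) xy by blast
  have zT: "z i \<in> T" if "i \<le> s" for i using z(2) that by auto
  have "z i \<notin> sphere E v m" if "i \<le> s" "m < j" for i m
    using zT[OF that(1)] T(1) that(2) sphere_unique[of "z i" E v j m] by auto
  moreover have "(?p ^^ Suc h) (z 0) = (?p ^^ Suc h) (z s)" using T(4) zT by simp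
  moreover have "(?p ^^ h) (z 0) \<noteq> (?p ^^ h) (z s)" using z(3) zT[of 0] zT[of s] by auto
  ultimately have "has_cycle E k"
    unfolding s(2) using tree_cycle[OF sym z(1), of j v h] zT[of 0] zT[of s] T(1) hj by blast
  then show False using no by simp
qed

section \<open>Sphere packing and the colour count\<close>

lemma sphere_packing:
  assumes sym: "sym E" and E: "E \<subseteq> V \<times> V" and fin: "finite V"
    and card: "\<And>v. v \<in> V \<Longrightarrow> N \<le> card (sphere E v l)"
  obtains M where "M \<subseteq> V" "card M * N \<le> card V"
    "\<And>u. u \<in> V \<Longrightarrow> \<exists>v\<in>M. \<exists>j\<le>2 * l. u \<in> sphere E v j"
proof -
  define \<F> where "\<F> = {M. M \<subseteq> V \<and> disjoint_family_on (\<lambda>v. sphere E v l) M}"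
  have "finite \<F>" using fin by (simp add: \<F>_def)
  moreover have "{} \<in> \<F>" by (simp add: \<F>_def disjoint_family_on_def)
  ultimately obtain M where M\<F>: "M \<in> \<F>" and max: "\<And>M'. M' \<in> \<F> \<Longrightarrow> M \<subseteq> M' \<Longrightarrow> M = M'"
    using finite_has_maximal[of \<F>] by blast
  have M: "M \<subseteq> V" "disjoint_family_on (\<lambda>v. sphere E v l) M"
    using M\<F> by (simp_all add: \<F>_def)
  have fM: "finite M" using M(1) fin finite_subset by blast
  have sub: "sphere E v l \<subseteq> V" if "v \<in> V" for v using sphere_subset[OF E that] .
  have "card M * N \<le> (\<Sum>v\<in>M. card (sphere E v l))"
    using sum_mono[of M "\<lambda>_. N" "\<lambda>v. card (sphere E v l)"] card M(1) by auto
  also have "\<dots> = card (\<Union>v\<in>M. sphere E v l)"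
    using M fM finite_subset[OF sub fin]
    by (intro card_UN_disjoint[symmetric]) (auto simp: disjoint_family_on_def)
  also have "\<dots> \<le> card V" using sub M(1) fin by (intro card_mono) auto
  finally have "card M * N \<le> card V" .
  moreover have "\<exists>v\<in>M. \<exists>j\<le>2 * l. u \<in> sphere E v j" if u: "u \<in> V" for u
  proof (cases "u \<in> M")
    case True
    then show ?thesis by (intro bexI[of _ u] exI[of _ 0]) auto
  next
    case False
    \<comment> \<open>By maximality the sphere around \<open>u\<close> meets one around some
      \<open>v\<close> in \<open>M\<close>; walking through a common point joins \<open>v\<close> to
      \<open>u\<close> in \<open>2 * l\<close> steps.\<close>
    then have "insert u M \<notin> \<F>" using max[of "insert u M"] by blast
    then obtain v w where v: "v \<in> M" "w \<in> sphere E u l" "w \<in> sphere E v l"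
      using M u by (fastforce simp: \<F>_def disjoint_family_on_def)
    have "(w, u) \<in> E ^^ l" "(v, w) \<in> E ^^ l"
      using v relpow_sym[OF sym] by (auto simp: sphere_def)
    then have "(v, u) \<in> E ^^ (l + l)" by (auto simp: relpow_add)
    then show ?thesis using relpow_sphere[of v u "l + l" E] v(1) by (auto simp: mult_2)
  qed
  ultimately show thesis using that M(1) by blast
qed

text \<open>Each vertex is coloured by a centre, its distance from it (one of
  \<open>2 * l + 1\<close> values) and its colour within that sphere. Adjacent vertices agreeing in
  the first two lie in one sphere and differ in the third. The condition \<open>4 * l < k\<close>
  admits all radii up to \<open>2 * l\<close>.\<close>

lemma chromatic_number_le:
  fixes G :: "'a pair_pre_digraph"
  assumes G: "pair_graph G" and k: "odd k" "4 * l < k"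
    and even: "\<And>i. 2 \<le> i \<Longrightarrow> i \<le> l \<Longrightarrow> \<not> has_cycle (parcs G) (2 * i)"
    and odd: "\<not> has_cycle (parcs G) k"
    and deg: "\<And>x. x \<in> pverts G \<Longrightarrow> D \<le> card (parcs G `` {x})"
  shows "\<exists>m. m * (D - 2) ^ l \<le> card (pverts G) \<and> chromatic_number G \<le> m * (2 * l + 1) * (2 * k)"
proof -
  interpret pair_graph G by fact
  let ?E = "parcs G" and ?V = "pverts G"
  have sym: "sym ?E" using sym_arcs by (simp add: symmetric_def)
  have irr: "irrefl ?E" using pair_no_loops by (force simp: irrefl_def)
  have E: "?E \<subseteq> ?V \<times> ?V" using in_arcsD1 in_arcsD2 by auto
  note V = pair_finite_verts
  have "(D - 2) ^ l \<le> card (sphere ?E v l)" if "v \<in> ?V" for v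
    using card_sphere_ge[OF sym irr E V that even deg, of l] by simp
  then obtain M where M: "M \<subseteq> ?V" "card M * (D - 2) ^ l \<le> card ?V"
    "\<And>u. u \<in> ?V \<Longrightarrow> \<exists>v\<in>M. \<exists>j\<le>2 * l. u \<in> sphere ?E v j"
    using sphere_packing[OF sym E V, of "(D - 2) ^ l" l] by metis
  have "\<exists>f. f ` sphere ?E v j \<subseteq> {..<2 * k} \<and>
    (\<forall>x\<in>sphere ?E v j. \<forall>y\<in>sphere ?E v j. (x, y) \<in> ?E \<longrightarrow> f x \<noteq> f y)" if "v \<in> M" "j \<le> 2 * l" for v j
  proof (rule degenerate_coloring[OF _ sym irr])
    show fin: "finite (sphere ?E v j)"
      using finite_subset[OF sphere_subset[OF E] V] that M(1) by blast
    show "\<exists>x\<in>S. card (?E `` {x} \<inter> S) < 2 * k" if "S \<subseteq> sphere ?E v j" "S \<noteq> {}" for S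
      using sphere_degenerate[OF sym irr fin k(1) _ odd that] k(2) \<open>j \<le> 2 * l\<close> by simp
  qed
  then obtain f where f: "\<And>v j. v \<in> M \<Longrightarrow> j \<le> 2 * l \<Longrightarrow> f v j ` sphere ?E v j \<subseteq> {..<2 * k}"
    "\<And>v j x y. v \<in> M \<Longrightarrow> j \<le> 2 * l \<Longrightarrow> x \<in> sphere ?E v j \<Longrightarrow> y \<in> sphere ?E v j \<Longrightarrow> (x, y) \<in> ?E
      \<Longrightarrow> f v j x \<noteq> f v j y"
    by metis
  obtain r d where rd: "\<And>u. u \<in> ?V \<Longrightarrow> r u \<in> M \<and> d u \<le> 2 * l \<and> u \<in> sphere ?E (r u) (d u)"
    using M(3) by metis
  let ?T = "M \<times> {..2 * l} \<times> {..<2 * k}"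
  let ?g = "\<lambda>u. (r u, d u, f (r u) (d u) u)"
  have "chromatic_number G \<le> card ?T"
  proof (rule chromatic_number_le_card[OF _ _ _ G])
    show "finite ?T" using finite_subset[OF M(1) V] by simp
    show "?g ` ?V \<subseteq> ?T" using rd f(1) by blast
    show "?g u \<noteq> ?g v" if "(u, v) \<in> ?E" for u v
      using rd[OF in_arcsD1[OF that]] rd[OF in_arcsD2[OF that]] f(2)[of "r u" "d u" u v] that by auto
  qed
  then show ?thesis using M(2) by (intro exI[of _ "card M"]) (simp add: card_cartesian_product algebra_simps)
qed

theorem theorem1p3:
  fixes l k n :: nat and c :: real and G :: "'a pair_pre_digraph"
  assumes "l \<ge> 2"
    and "k \<ge> 4 * l + 1" and "odd k"
    and "c > 0"
    and "pair_graph G"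
    and "n = card (pverts G)"
    and "family_free (even_cycles l \<union> {cycle_graph k}) G"
    and "real (min_degree G) \<ge> c * real n powr (1 / real l)"
  shows "real (chromatic_number G) < (4 * real k) ^ (l + 1) / c ^ l"
proof -
  interpret pair_graph G by fact
  let ?D = "min_degree G"
  have chn: "chromatic_number G \<le> n"
    unfolding assms(6) using pair_no_loops
    by (intro chromatic_number_le_card[where g = "\<lambda>x. x"] \<open>pair_graph G\<close>) force+
  have k: "real k \<ge> 1" "2 * real l + 1 \<le> real k" using assms(1,2) by linarith+
  have pow: "(c * real n powr (1 / real l)) ^ l = c ^ l * real n" if "n > 0"
    using that assms(1) by (simp add: power_mult_distrib powr_realpow[symmetric] powr_powr)
  have "real (chromatic_number G) * c ^ l < (4 * real k) ^ (l + 1)"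
  \<comment> \<open>The null graph is treated apart: its minimum degree is unspecified, and later
    \<open>n\<close> is cancelled.\<close>
  proof (cases "n = 0")
    case True
    then show ?thesis using chn k(1) by simp
  next
    case False
    then have n: "n > 0" by simp
    show ?thesis
    \<comment> \<open>From 4 on, \<open>?D \<le> 2 * (?D - 2)\<close>, so the loss of 2 in the
      sphere growth costs only a factor 2. Below 4, \<open>c ^ l * n\<close> is at most
      \<open>4 ^ l\<close>.\<close>
    proof (cases "?D < 4")
      case True
      have "real (chromatic_number G) * c ^ l \<le> c ^ l * real n"
        using chn assms(4) by (simp add: mult.commute)
      also have "\<dots> = (c * real n powr (1 / real l)) ^ l" using pow[OF n] by simp
      also have "\<dots> \<le> 4 ^ l" using True assms(4,8) by (intro power_mono) auto
      also have "\<dots> < 4 ^ (l + 1)" by simp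
      also have "\<dots> \<le> (4 * real k) ^ (l + 1)" using k(1) by (intro power_mono) auto
      finally show ?thesis .
    next
      case False
      have "?D \<le> card (parcs G `` {x})" if "x \<in> pverts G" for x
      proof -
        have "?D \<le> out_degree (with_proj G) x"
          unfolding min_degree_def using that pair_finite_verts by (intro Min_le) auto
        \<comment> \<open>Degrees count arcs; \<open>snd\<close> maps the arcs leaving
          \<open>x\<close> injectively to its neighbours.\<close>
        also have "out_degree (with_proj G) x = card (snd ` out_arcs (with_proj G) x)"
          unfolding out_degree_def
          by (rule card_image[symmetric]) (auto simp: inj_on_def out_arcs_def)
        also have "snd ` out_arcs (with_proj G) x = parcs G `` {x}"
          by (force simp: out_arcs_def)
        finally show ?thesis .
      qed
      moreover have "\<not> has_cycle (parcs G) (2 * i)" if "2 \<le> i" "i \<le> l" for i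
        using contains_copy_cycle_graph[OF \<open>pair_graph G\<close>, of "2 * i"] assms(7) that
        by (auto simp: family_free_def even_cycles_def)
      moreover have "\<not> has_cycle (parcs G) k"
        using contains_copy_cycle_graph[OF \<open>pair_graph G\<close>, of k] assms(1,2,7)
        by (auto simp: family_free_def)
      ultimately obtain m where m: "m * (?D - 2) ^ l \<le> n"
        "chromatic_number G \<le> m * (2 * l + 1) * (2 * k)"
        using chromatic_number_le[OF \<open>pair_graph G\<close> assms(3), of l ?D] assms(2,6) by auto
      have "c * real n powr (1 / real l) \<le> 2 * real (?D - 2)"
        using assms(8) False by (simp add: of_nat_diff)
      then have "c ^ l * real n \<le> (2 * real (?D - 2)) ^ l"
        unfolding pow[OF n, symmetric] using assms(4) by (intro power_mono) auto
      then have "real m * (c ^ l * real n) \<le> 2 ^ l * real (m * (?D - 2) ^ l)"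
        using mult_left_mono[of _ _ "real m"] by (simp add: power_mult_distrib mult.left_commute)
      also have "\<dots> \<le> 2 ^ l * real n" using m(1) by (intro mult_left_mono) (simp_all only: of_nat_le_iff, simp)
      \<comment> \<open>Cancelling \<open>n\<close> bounds the number of centres by
        \<open>2 ^ l / c ^ l\<close>.\<close>
      finally have mc: "real m * c ^ l \<le> 2 ^ l" using n by simp
      have "real (chromatic_number G) \<le> real (m * (2 * l + 1) * (2 * k))"
        using m(2) by (simp only: of_nat_le_iff)
      also have "\<dots> = real m * ((2 * real l + 1) * (2 * real k))" by (simp add: algebra_simps)
      also have "\<dots> \<le> real m * (real k * (2 * real k))"
        using k by (intro mult_left_mono mult_right_mono) auto
      finally have "real (chromatic_number G) * c ^ l \<le> real m * (real k * (2 * real k)) * c ^ l"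
        using assms(4) by (intro mult_right_mono) auto
      also have "\<dots> = (real m * c ^ l) * (2 * real k ^ 2)" by (simp add: power2_eq_square)
      also have "\<dots> \<le> 2 ^ l * (2 * real k ^ 2)" using mc by (intro mult_right_mono) auto
      also have "\<dots> = 2 ^ (l + 1) * real k ^ 2" by simp
      \<comment> \<open>The strict inequality comes from the slack between the bases 2 and
        4.\<close>
      also have "\<dots> < 4 ^ (l + 1) * real k ^ 2"
        using k(1) by (intro mult_strict_right_mono power_strict_mono) auto
      also have "\<dots> \<le> 4 ^ (l + 1) * real k ^ (l + 1)"
        using k(1) assms(1) by (intro mult_left_mono power_increasing) auto
      finally show ?thesis by (simp only: power_mult_distrib)
    qed
  qed
  then show ?thesis using assms(4) by (simp add: pos_less_divide_eq)
qed

end
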